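(* For every integer $n\geq 0$, $5\mid MO(2,5n+1)$.
   Context: For $t\geq 1$, the integers $MO(t,n)$ are defined by the formal power series $$U_t(q)=\sum_{n\geq0}MO(t,n)\,q^n=\sum_{1\leq k_1<k_2<\cdots<k_t}\frac{q^{k_1+k_2+\cdots+k_t}}{(1-q^{k_1})^2(1-q^{k_2})^2\cdots(1-q^{k_t})^2}.$$ *)

theory Defs
  imports "HOL-Analysis.Analysis"
begin

definition strict_tuples :: "nat \<Rightarrow> nat list set" where
  "strict_tuples t = {ks. length ks = t \<and> sorted_wrt (<) ks \<and> (\<forall>k\<in>set ks. 1 \<le> k)}"

definition U_term :: "nat list \<Rightarrow> rat fps" where
  "U_term ks = fps_X ^ sum_list ks / (\<Prod>k\<leftarrow>ks. (1 - fps_X ^ k) ^ 2)"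

text \<open>The infinite sum is taken in the usual (X-adic) topology on formal power series.\<close>

definition U :: "nat \<Rightarrow> rat fps" where
  "U t = (\<Sum>\<^sub>\<infinity>ks\<in>strict_tuples t. U_term ks)"

text \<open>
  Division of formal power series needs a field of coefficients, so \<open>U t\<close> lives over the rationals.
  The lemmas \<open>U_has_sum\<close> and \<open>of_int_MO\<close> below show that the infinite sum and the definite
  description are well defined.
\<close>

definition MO :: "nat \<Rightarrow> nat \<Rightarrow> int" where
  "MO t n = (THE m. of_int m = fps_nth (U t) n)"

lemma U_term_denom_nth_0:
  assumes "ks \<in> strict_tuples t"
  shows "fps_nth (\<Prod>k\<leftarrow>ks. (1 - fps_X ^ k :: rat fps) ^ 2) 0 = 1"
proof -
  have "\<forall>k\<in>set ks. 1 \<le> k"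
    using assms by (simp add: strict_tuples_def)
  then show ?thesis
    by (induction ks) (auto simp: power2_eq_square fps_X_power_nth)
qed

lemma U_term_nth_less:
  assumes "ks \<in> strict_tuples t" "n < sum_list ks"
  shows "fps_nth (U_term ks) n = 0"
proof -
  have "U_term ks = fps_X ^ sum_list ks * inverse (\<Prod>k\<leftarrow>ks. (1 - fps_X ^ k) ^ 2)"
    unfolding U_term_def using U_term_denom_nth_0[OF assms(1)] by (simp add: fps_divide_unit)
  then show ?thesis
    using assms(2) by (simp add: fps_X_power_mult_nth)
qed

lemma finite_strict_tuples_le: "finite {ks \<in> strict_tuples t. sum_list ks \<le> n}"
proof (rule finite_subset)
  show "{ks \<in> strict_tuples t. sum_list ks \<le> n} \<subseteq> {ks. set ks \<subseteq> {..n} \<and> length ks = t}"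
    by (auto simp: strict_tuples_def dest: member_le_sum_list)
  show "finite {ks. set ks \<subseteq> {..n} \<and> length ks = t}"
    by (rule finite_lists_length_eq) simp
qed

lemma U_has_sum: "(U_term has_sum U t) (strict_tuples t)"
  and U_nth: "fps_nth (U t) n = (\<Sum>ks | ks \<in> strict_tuples t \<and> sum_list ks \<le> n. fps_nth (U_term ks) n)"
proof -
  define G where "G = Abs_fps (\<lambda>n. \<Sum>ks | ks \<in> strict_tuples t \<and> sum_list ks \<le> n. fps_nth (U_term ks) n)"
  have "(U_term has_sum G) (strict_tuples t)"
    unfolding has_sum_def
  proof (rule tendsto_fpsI)
    fix n
    let ?A = "{ks \<in> strict_tuples t. sum_list ks \<le> n}"
    have "fps_nth (sum U_term B) n = fps_nth G n"
      if "finite B" "?A \<subseteq> B" "B \<subseteq> strict_tuples t" for B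
    proof -
      have "fps_nth (sum U_term B) n = (\<Sum>ks\<in>B. fps_nth (U_term ks) n)"
        by (simp add: fps_sum_nth)
      also have "\<dots> = (\<Sum>ks\<in>?A. fps_nth (U_term ks) n)"
        using that by (intro sum.mono_neutral_right) (auto intro!: U_term_nth_less[of _ t])
      finally show ?thesis
        by (simp add: G_def)
    qed
    then show "\<forall>\<^sub>F B in finite_subsets_at_top (strict_tuples t). fps_nth (sum U_term B) n = fps_nth G n"
      unfolding eventually_finite_subsets_at_top using finite_strict_tuples_le[of t n] by blast
  qed
  moreover from this have "U t = G"
    unfolding U_def by (rule infsumI)
  ultimately show "(U_term has_sum U t) (strict_tuples t)"
    and "fps_nth (U t) n = (\<Sum>ks | ks \<in> strict_tuples t \<and> sum_list ks \<le> n. fps_nth (U_term ks) n)"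
    by (simp_all add: G_def)
qed

lemma inverse_nth_Ints:
  fixes f :: "rat fps"
  assumes "\<And>i. fps_nth f i \<in> \<int>" "fps_nth f 0 = 1"
  shows "fps_nth (inverse f) n \<in> \<int>"
proof (induction n rule: less_induct)
  case (less n)
  show ?case
  proof (cases n)
    case 0
    then show ?thesis using assms(2) by simp
  next
    case (Suc m)
    have "(inverse f * f) = 1"
      using assms(2) by (intro inverse_mult_eq_1) simp
    then have "fps_nth (inverse f * f) n = 0"
      using Suc by simp
    then have "(\<Sum>i=0..n. fps_nth (inverse f) i * fps_nth f (n - i)) = 0"
      by (simp only: fps_mult_nth)
    moreover have "(\<Sum>i=0..n. fps_nth (inverse f) i * fps_nth f (n - i))
        = (\<Sum>i<n. fps_nth (inverse f) i * fps_nth f (n - i)) + fps_nth (inverse f) n"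
      by (simp only: atLeast0AtMost lessThan_Suc_atMost[symmetric] sum.lessThan_Suc diff_self_eq_0 assms(2) mult_1_right)
    ultimately have "fps_nth (inverse f) n = - (\<Sum>i<n. fps_nth (inverse f) i * fps_nth f (n - i))"
      by simp
    also have "\<dots> \<in> \<int>"
      using less assms(1) by (intro Ints_minus Ints_sum Ints_mult) auto
    finally show ?thesis .
  qed
qed

lemma mult_nth_Ints:
  fixes f g :: "rat fps"
  assumes "\<And>i. fps_nth f i \<in> \<int>" "\<And>i. fps_nth g i \<in> \<int>"
  shows "fps_nth (f * g) n \<in> \<int>"
  unfolding fps_mult_nth using assms by (intro Ints_sum Ints_mult) auto

lemma U_term_nth_Ints:
  assumes "ks \<in> strict_tuples t"
  shows "fps_nth (U_term ks) n \<in> \<int>"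
proof -
  let ?D = "\<Prod>k\<leftarrow>ks. (1 - fps_X ^ k :: rat fps) ^ 2"
  have "fps_nth ?D i \<in> \<int>" for i
    by (induction ks arbitrary: i)
      (auto simp: power2_eq_square fps_X_power_nth intro!: mult_nth_Ints)
  then have "fps_nth (inverse ?D) i \<in> \<int>" for i
    using U_term_denom_nth_0[OF assms] by (intro inverse_nth_Ints) auto
  moreover have "U_term ks = fps_X ^ sum_list ks * inverse ?D"
    unfolding U_term_def using U_term_denom_nth_0[OF assms] by (simp add: fps_divide_unit)
  ultimately show ?thesis
    by (simp add: fps_X_power_mult_nth)
qed

lemma of_int_MO: "of_int (MO t n) = fps_nth (U t) n"
proof -
  have "fps_nth (U t) n \<in> \<int>"
    unfolding U_nth by (intro Ints_sum) (auto intro: U_term_nth_Ints)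
  then obtain m where "fps_nth (U t) n = of_int m"
    by (auto elim: Ints_cases)
  then show ?thesis
    by (simp add: MO_def)
qed

end

theory Submission
  imports Defs
begin

text \<open>
  Expanding the double poles gives \<open>MO(2,n) = \<Sum> a * b\<close> over all \<open>a * x + b * y = n\<close> in
  positive integers with \<open>x < y\<close>: the parts are \<open>x\<close> and \<open>y\<close>, with multiplicities \<open>a\<close>
  and \<open>b\<close> (lemma \<open>MO_2_eq_solution_sum\<close>).  An elementary argument in the style of Liouville
  then shows \<open>8 * MO(2,n) = \<sigma>\<^sub>3(n) - (2 * n - 1) * \<sigma>\<^sub>1(n)\<close> for positive \<open>n\<close>, where
  \<open>\<sigma>\<^sub>k(n)\<close> is the sum of the \<open>k\<close>-th powers of the divisors of \<open>n\<close>
  (lemma \<open>MO_2_divisor_sum\<close>).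

  The start is \<open>4 * a * b = (a + b)\<^sup>2 - (a - b)\<^sup>2\<close>.  The substitution
  \<open>a * x + b * y = (a + b) * x + b * (y - x)\<close> (lemma \<open>solution_sum_shear\<close>) turns the sum of
  \<open>(a + b)\<^sup>2\<close> into a sum of \<open>a\<^sup>2\<close> over the solutions with \<open>b < a\<close>, and the sum of
  \<open>(a - b)\<^sup>2\<close> into a sum of \<open>a\<^sup>2\<close> over the solutions with \<open>x < y\<close>, up to terms with
  \<open>x = y\<close>.  Reducing \<open>b\<close> modulo \<open>a\<close> compares these two sums
  (lemma \<open>solution_sum_reduce\<close>): their difference is made up of the solutions with \<open>x = y\<close> and of
  those with \<open>x \<le> y\<close> and \<open>a dvd b\<close>, and both families are parametrised by the divisors of \<open>n\<close>
  and a free integer in an interval.  So only divisor sums remain.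

  If \<open>n\<close> is congruent to 1 modulo 5, then so is \<open>2 * n - 1\<close>, and \<open>8 * MO(2,n)\<close> is congruent to the
  sum of \<open>d ^ 3 - d\<close> over the divisors \<open>d\<close> of \<open>n\<close>.  The complementary divisor \<open>n div d\<close> is the
  inverse of \<open>d\<close> modulo 5, and the terms of a residue and its inverse add up to 0 modulo 5:
  \<open>d ^ 3 - d\<close> vanishes at 1 and 4, and takes the values 1 and -1 at the inverse pair 2 and 3.
\<close>

section \<open>Sums over the positive solutions of a * x + b * y = n\<close>

definition solutions :: "nat \<Rightarrow> (nat \<times> nat \<times> nat \<times> nat) set" where
  "solutions n = {(a, b, x, y). 0 < a \<and> 0 < b \<and> 0 < x \<and> 0 < y \<and> a * x + b * y = n}"

definition solution_sum ::
    "nat \<Rightarrow> (nat \<Rightarrow> nat \<Rightarrow> nat \<Rightarrow> nat \<Rightarrow> bool) \<Rightarrow> (nat \<Rightarrow> nat \<Rightarrow> nat \<Rightarrow> nat \<Rightarrow> int) \<Rightarrow> int" where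
  "solution_sum n P f = (\<Sum>(a, b, x, y) | (a, b, x, y) \<in> solutions n \<and> P a b x y. f a b x y)"

lemma solutions_le:
  assumes "(a, b, x, y) \<in> solutions n"
  shows "a \<le> n" "b \<le> n" "x \<le> n" "y \<le> n"
proof -
  have "a * 1 \<le> a * x" "1 * x \<le> a * x" "b * 1 \<le> b * y" "1 * y \<le> b * y" "a * x + b * y = n"
    using assms unfolding solutions_def by (auto simp del: mult_1 mult_1_right intro!: mult_le_mono)
  then show "a \<le> n" "b \<le> n" "x \<le> n" "y \<le> n" by linarith+
qed

lemma finite_solutions: "finite {(a, b, x, y). (a, b, x, y) \<in> solutions n \<and> P a b x y}"
  by (rule finite_subset[of _ "{..n} \<times> {..n} \<times> {..n} \<times> {..n}"]) (auto dest: solutions_le)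

lemma solution_sum_cong:
  assumes "\<And>a b x y. (a, b, x, y) \<in> solutions n \<Longrightarrow> P a b x y \<longleftrightarrow> Q a b x y"
    and "\<And>a b x y. (a, b, x, y) \<in> solutions n \<Longrightarrow> Q a b x y \<Longrightarrow> f a b x y = g a b x y"
  shows "solution_sum n P f = solution_sum n Q g"
  unfolding solution_sum_def using assms by (intro sum.cong) auto

lemma solution_sum_split:
  "solution_sum n P f = solution_sum n (\<lambda>a b x y. P a b x y \<and> Q a b x y) f
     + solution_sum n (\<lambda>a b x y. P a b x y \<and> \<not> Q a b x y) f"
  unfolding solution_sum_def
  by (subst sum.union_disjoint[symmetric]) (auto simp: finite_solutions intro!: sum.cong)

lemma solution_sum_add:
  "solution_sum n P (\<lambda>a b x y. f a b x y + g a b x y) = solution_sum n P f + solution_sum n P g"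
  unfolding solution_sum_def by (simp add: sum.distrib case_prod_unfold)

lemma solution_sum_diff:
  "solution_sum n P (\<lambda>a b x y. f a b x y - g a b x y) = solution_sum n P f - solution_sum n P g"
  unfolding solution_sum_def by (simp add: sum_subtractf case_prod_unfold)

lemma solution_sum_mult:
  "solution_sum n P (\<lambda>a b x y. c * f a b x y) = c * solution_sum n P f"
  unfolding solution_sum_def by (simp add: sum_distrib_left case_prod_unfold)

lemma solution_sum_swap:
  "solution_sum n P f = solution_sum n (\<lambda>a b x y. P b a y x) (\<lambda>a b x y. f b a y x)"
  unfolding solution_sum_def
  by (rule sum.reindex_bij_witness[where i = "\<lambda>(a, b, x, y). (b, a, y, x)"
        and j = "\<lambda>(a, b, x, y). (b, a, y, x)"]) (auto simp: solutions_def)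

text \<open>
  This is \<open>a * x + b * y = (a + b) * x + b * (y - x)\<close>: one step of the subtractive Euclidean
  algorithm on the parts, compensated on the multiplicities.
\<close>

lemma solution_sum_shear:
  "solution_sum n (\<lambda>a b x y. x < y) (\<lambda>a b x y. f (a + b) b)
     = solution_sum n (\<lambda>a b x y. b < a) (\<lambda>a b x y. f a b)"
proof -
  have less_diff: "b * x + b * (y - x) = b * y" "b * (y - x) + b * x = b * y"
    if "x < y" for b x y :: nat
    using that by (simp_all add: distrib_left[symmetric])
  have diff_less: "(a - b) * x + b * (x + y) = a * x + b * y" if "b < a" for a b x y :: nat
  proof -
    have "a * x = (a - b) * x + b * x"
      using that by (metis add_mult_distrib le_add_diff_inverse2 less_imp_le)
    then show ?thesis by (simp add: distrib_left)
  qed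
  show ?thesis
    unfolding solution_sum_def
    by (rule sum.reindex_bij_witness[where i = "\<lambda>(a, b, x, y). (a - b, b, x, x + y)"
          and j = "\<lambda>(a, b, x, y). (a + b, b, x, y - x)"])
      (auto simp: solutions_def diff_less less_diff add_mult_distrib add.assoc)
qed

text \<open>The equation becomes \<open>(a + b) * x = n\<close>, so \<open>d = a + b\<close> is an arbitrary divisor of \<open>n\<close>.\<close>

lemma solution_sum_diagonal:
  assumes "0 < n"
  shows "solution_sum n (\<lambda>a b x y. x = y) (\<lambda>a b x y. f a b)
     = (\<Sum>d | d dvd n. \<Sum>a = 1..<d. f a (d - a))"
proof -
  have "solution_sum n (\<lambda>a b x y. x = y) (\<lambda>a b x y. f a b)
      = (\<Sum>(d, a) \<in> (SIGMA d:{d. d dvd n}. {1..<d}). f a (d - a))"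
    unfolding solution_sum_def
    by (rule sum.reindex_bij_witness[where i = "\<lambda>(d, a). (a, d - a, n div d, n div d)"
          and j = "\<lambda>(a, b, x, y). (a + b, a)"])
      (use assms in \<open>auto simp: solutions_def add_mult_distrib[symmetric] dvd_div_eq_0_iff\<close>)
  also have "\<dots> = (\<Sum>d | d dvd n. \<Sum>a = 1..<d. f a (d - a))"
    using assms by (subst sum.Sigma) (auto simp: finite_divisors_nat)
  finally show ?thesis .
qed

text \<open>
  The next two lemmas are division with remainder in \<open>{1..y}\<close> instead of \<open>{0..<y}\<close>: positive
  parts have positive remainders.
\<close>

lemma positive_remainder:
  fixes x y :: nat
  assumes "0 < x" "0 < y"
  shows "(x - 1) mod y + 1 \<le> y" "(x - 1) mod y + 1 + (x - 1) div y * y = x"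
  using assms by (simp_all add: Suc_leI mod_less_divisor)

lemma pred_div_mod:
  fixes c x y :: nat
  assumes "0 < x" "x \<le> y"
  shows "(x + c * y - Suc 0) div y = c" "Suc ((x + c * y - Suc 0) mod y) = x"
proof -
  obtain z where "x = Suc z" using assms(1) by (cases x) auto
  then show "(x + c * y - Suc 0) div y = c" "Suc ((x + c * y - Suc 0) mod y) = x"
    using assms by simp_all
qed

text \<open>
  The whole Euclidean division of \<open>b\<close> by \<open>a\<close> in one step: with \<open>b = q * a + r\<close> the equation
  reads \<open>a * (x + q * y) + r * y = n\<close>, where \<open>r < a\<close>, and \<open>r\<close> is positive because \<open>a\<close>
  does not divide \<open>b\<close>.  The condition \<open>x \<le> y\<close> makes this invertible, since \<open>x\<close> and \<open>q\<close> are
  then the remainder and the quotient of \<open>x + q * y\<close> by \<open>y\<close>.  Since \<open>a\<close> does not change,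
  the summand may be any function of \<open>a\<close>.
\<close>

lemma solution_sum_reduce:
  "solution_sum n (\<lambda>a b x y. x \<le> y \<and> \<not> a dvd b) (\<lambda>a b x y. f a)
     = solution_sum n (\<lambda>a b x y. b < a) (\<lambda>a b x y. f a)"
proof -
  have fwd: "a * (x + b div a * y) + b mod a * y = a * x + b * y" for a b x y :: nat
    by (metis add.assoc add_mult_distrib distrib_left mult.assoc mult_div_mod_eq)
  have bwd: "a * ((x - 1) mod y + 1) + (b + a * ((x - 1) div y)) * y = a * x + b * y"
    if "0 < x" "0 < y" for a b x y :: nat
  proof -
    have "a * ((x - 1) mod y + 1) + (b + a * ((x - 1) div y)) * y
        = a * ((x - 1) mod y + 1 + (x - 1) div y * y) + b * y"
      by (simp only: algebra_simps)
    then show ?thesis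
      by (simp only: positive_remainder(2)[OF that])
  qed
  show ?thesis
    unfolding solution_sum_def
  proof (rule sum.reindex_bij_witness[where
        i = "\<lambda>(a, b, x, y). (a, b + a * ((x - 1) div y), (x - 1) mod y + 1, y)"
        and j = "\<lambda>(a, b, x, y). (a, b mod a, x + b div a * y, y)"], goal_cases)
    case (1 s)
    then show ?case by (auto simp: solutions_def pred_div_mod)
  next
    case (2 s)
    then show ?case using fwd by (auto simp: solutions_def dvd_eq_mod_eq_0)
  next
    case (3 s)
    then show ?case
      using positive_remainder by (auto simp: solutions_def simp del: One_nat_def)
  next
    case (4 s)
    then obtain a b x y where s: "s = (a, b, x, y)" "0 < a" "0 < b" "0 < x" "0 < y" "b < a"
        "a * x + b * y = n"
      by (auto simp: solutions_def)
    have "\<not> a dvd b" using s by (simp add: nat_dvd_not_less)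
    then show ?case
      using s bwd[of x y a b] positive_remainder(1)[of x y]
      by (simp add: solutions_def dvd_add_left_iff)
  qed auto
qed

text \<open>
  The solutions that the previous reduction leaves out.  With \<open>b = a * c\<close> the equation reads
  \<open>x + c * y = n div a\<close>.  For each \<open>y\<close> below \<open>n div a\<close>, division with remainder gives exactly one
  pair of \<open>c > 0\<close> and \<open>0 < x \<le> y\<close>, hence the weight \<open>n div a - 1\<close>.
\<close>

lemma solution_sum_multiple:
  assumes "0 < n"
  shows "solution_sum n (\<lambda>a b x y. x \<le> y \<and> a dvd b) (\<lambda>a b x y. f a)
     = (\<Sum>d | d dvd n. (int (n div d) - 1) * f d)"
proof -
  have "solution_sum n (\<lambda>a b x y. x \<le> y \<and> a dvd b) (\<lambda>a b x y. f a)
      = (\<Sum>(d, y) \<in> (SIGMA d:{d. d dvd n}. {1..<n div d}). f d)"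
    unfolding solution_sum_def
  proof (rule sum.reindex_bij_witness[where
        i = "\<lambda>(d, y). (d, d * ((n div d - 1) div y), (n div d - 1) mod y + 1, y)"
        and j = "\<lambda>(a, b, x, y). (a, y)"], goal_cases)
    case (1 s)
    then obtain a c x y where s: "s = (a, a * c, x, y)" "0 < a" "0 < c" "0 < x" "0 < y" "x \<le> y"
        "a * x + a * c * y = n"
      by (auto simp: solutions_def elim!: dvdE)
    have "n = a * (x + c * y)" using s by (simp add: algebra_simps)
    then have "n div a = x + c * y" using s by simp
    then show ?case using s by (simp add: pred_div_mod)
  next
    case (2 s)
    then obtain a c x y where s: "s = (a, a * c, x, y)" "0 < a" "0 < c" "0 < x" "0 < y" "x \<le> y"
        "a * x + a * c * y = n"
      by (auto simp: solutions_def elim!: dvdE)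
    have n: "n = a * (x + c * y)" using s by (simp add: algebra_simps)
    then have m: "n div a = x + c * y" using s by simp
    have "1 * y \<le> c * y" using s by (intro mult_le_mono) auto
    then have "y < x + c * y" using s by linarith
    then show ?case using s n m by simp
  next
    case (3 p)
    then show ?case by auto
  next
    case (4 p)
    then obtain d y where p: "p = (d, y)" "d dvd n" "0 < y" "y < n div d" by auto
    define m where "m = n div d"
    have n: "n = d * m" "0 < d" using p assms by (auto simp: m_def)
    have "0 < (m - 1) div y" using p by (simp add: m_def div_greater_zero_iff)
    moreover have "d * ((m - 1) mod y + 1) + d * ((m - 1) div y) * y = n"
      using positive_remainder(2)[of m y] p n by (metis distrib_left mult.assoc m_def gr_implies_not0 neq0_conv)
    ultimately show ?case
      using p n positive_remainder(1)[of m y]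
      by (auto simp: solutions_def m_def[symmetric])
  qed auto
  also have "\<dots> = (\<Sum>d | d dvd n. \<Sum>y = 1..<n div d. f d)"
    using assms by (subst sum.Sigma) (auto simp: finite_divisors_nat)
  also have "\<dots> = (\<Sum>d | d dvd n. (int (n div d) - 1) * f d)"
  proof (rule sum.cong)
    fix d assume "d \<in> {d. d dvd n}"
    then have "1 \<le> n div d" using assms by (auto simp: Suc_le_eq dvd_div_eq_0_iff)
    then show "(\<Sum>y = 1..<n div d. f d) = (int (n div d) - 1) * f d"
      by (simp add: of_nat_diff)
  qed simp
  finally show ?thesis .
qed

section \<open>Evaluating the sum of a * b over x < y\<close>

lemma solution_sum_symmetric:
  assumes "\<And>a b. f a b = f b a"
  shows "solution_sum n (\<lambda>a b x y. True) (\<lambda>a b x y. f a b)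
      = 2 * solution_sum n (\<lambda>a b x y. x < y) (\<lambda>a b x y. f a b)
        + solution_sum n (\<lambda>a b x y. x = y) (\<lambda>a b x y. f a b)" (is ?parts)
    and "solution_sum n (\<lambda>a b x y. True) (\<lambda>a b x y. f a b)
      = 2 * solution_sum n (\<lambda>a b x y. b < a) (\<lambda>a b x y. f a b)
        + solution_sum n (\<lambda>a b x y. a = b) (\<lambda>a b x y. f a b)" (is ?multiplicities)
proof -
  let ?S = "\<lambda>P. solution_sum n P (\<lambda>a b x y. f a b)"
  have "?S (\<lambda>a b x y. True) = ?S (\<lambda>a b x y. x < y) + ?S (\<lambda>a b x y. \<not> x < y)"
    using solution_sum_split[of n "\<lambda>a b x y. True" _ "\<lambda>a b x y. x < y"] by simp
  also have "?S (\<lambda>a b x y. \<not> x < y)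
      = ?S (\<lambda>a b x y. \<not> x < y \<and> x = y) + ?S (\<lambda>a b x y. \<not> x < y \<and> x \<noteq> y)"
    by (rule solution_sum_split)
  also have "?S (\<lambda>a b x y. \<not> x < y \<and> x = y) = ?S (\<lambda>a b x y. x = y)"
    by (rule solution_sum_cong) auto
  also have "?S (\<lambda>a b x y. \<not> x < y \<and> x \<noteq> y) = ?S (\<lambda>a b x y. x < y)"
    by (subst solution_sum_swap) (rule solution_sum_cong, auto simp: assms)
  finally show ?parts by simp
  have "?S (\<lambda>a b x y. True) = ?S (\<lambda>a b x y. b < a) + ?S (\<lambda>a b x y. \<not> b < a)"
    using solution_sum_split[of n "\<lambda>a b x y. True" _ "\<lambda>a b x y. b < a"] by simp
  also have "?S (\<lambda>a b x y. \<not> b < a)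
      = ?S (\<lambda>a b x y. \<not> b < a \<and> a = b) + ?S (\<lambda>a b x y. \<not> b < a \<and> a \<noteq> b)"
    by (rule solution_sum_split)
  also have "?S (\<lambda>a b x y. \<not> b < a \<and> a = b) = ?S (\<lambda>a b x y. a = b)"
    by (rule solution_sum_cong) auto
  also have "?S (\<lambda>a b x y. \<not> b < a \<and> a \<noteq> b) = ?S (\<lambda>a b x y. b < a)"
    by (subst solution_sum_swap) (rule solution_sum_cong, auto simp: assms)
  finally show ?multiplicities by simp
qed

text \<open>
  The order condition moves from the multiplicities to the parts at the cost of sums over
  divisors: \<open>solution_sum_reduce\<close> identifies \<open>b < a\<close> with \<open>x \<le> y\<close>, except that the
  solutions in which \<open>a\<close> divides \<open>b\<close> have no partner.
\<close>

lemma solution_sum_compare: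
  assumes "0 < n"
  shows "solution_sum n (\<lambda>a b x y. b < a) (\<lambda>a b x y. f a)
     = solution_sum n (\<lambda>a b x y. x < y) (\<lambda>a b x y. f a)
       + solution_sum n (\<lambda>a b x y. x = y) (\<lambda>a b x y. f a)
       - (\<Sum>d | d dvd n. (int (n div d) - 1) * f d)"
proof -
  let ?S = "\<lambda>P. solution_sum n P (\<lambda>a b x y. f a)"
  have "?S (\<lambda>a b x y. x \<le> y) = ?S (\<lambda>a b x y. x \<le> y \<and> a dvd b) + ?S (\<lambda>a b x y. b < a)"
    by (subst solution_sum_split[of _ _ _ "\<lambda>a b x y. a dvd b"]) (simp add: solution_sum_reduce)
  moreover have "?S (\<lambda>a b x y. x \<le> y)
      = ?S (\<lambda>a b x y. x \<le> y \<and> x < y) + ?S (\<lambda>a b x y. x \<le> y \<and> \<not> x < y)"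
    by (rule solution_sum_split)
  moreover have "?S (\<lambda>a b x y. x \<le> y \<and> x < y) = ?S (\<lambda>a b x y. x < y)"
    "?S (\<lambda>a b x y. x \<le> y \<and> \<not> x < y) = ?S (\<lambda>a b x y. x = y)"
    by (rule solution_sum_cong; auto)+
  ultimately show ?thesis
    by (simp add: solution_sum_multiple[OF assms])
qed

text \<open>The total contribution of the divisor \<open>d = a + b\<close> from the solutions with \<open>x = y\<close>.\<close>

lemma sum_below_quadratic:
  "(\<Sum>a = 1..<d. 2 * (int a)\<^sup>2 + (int a - int (d - a))\<^sup>2) = int d ^ 3 - 2 * (int d)\<^sup>2 + int d"
proof -
  have poly: "(\<Sum>a<m. 2 * (int a)\<^sup>2 + (2 * int a - c)\<^sup>2)
      = (int m - 1) * int m * (2 * int m - 1) - 2 * c * (int m - 1) * int m + int m * c\<^sup>2" for m c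
    by (induction m) (simp_all add: power2_eq_square algebra_simps)
  show ?thesis
  proof (cases "d = 0")
    case False
    then have "{..<d} = insert 0 {1..<d}" by auto
    then have "(\<Sum>a<d. 2 * (int a)\<^sup>2 + (2 * int a - int d)\<^sup>2)
        = (int d)\<^sup>2 + (\<Sum>a = 1..<d. 2 * (int a)\<^sup>2 + (2 * int a - int d)\<^sup>2)"
      by simp
    also have "(\<Sum>a = 1..<d. 2 * (int a)\<^sup>2 + (2 * int a - int d)\<^sup>2)
        = (\<Sum>a = 1..<d. 2 * (int a)\<^sup>2 + (int a - int (d - a))\<^sup>2)"
      by (intro sum.cong) (auto simp: of_nat_diff)
    finally show ?thesis
      unfolding poly by (simp add: power2_eq_square power3_eq_cube algebra_simps)
  qed simp
qed

lemma solution_sum_product: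
  assumes "0 < n"
  shows "8 * solution_sum n (\<lambda>a b x y. x < y) (\<lambda>a b x y. int a * int b)
    = (\<Sum>d | d dvd n. int d ^ 3) - (2 * int n - 1) * (\<Sum>d | d dvd n. int d)"
proof -
  \<comment> \<open>The identity is linear algebra in five kinds of sums: over all solutions, over those with
    equal parts, and the three sums \<open>A\<close>, \<open>B\<close> and \<open>T\<close> on one side of a diagonal.\<close>
  define all parts_eq where
    "all f = solution_sum n (\<lambda>a b x y. True) (\<lambda>a b x y. f (int a) (int b))" and
    "parts_eq f = solution_sum n (\<lambda>a b x y. x = y) (\<lambda>a b x y. f (int a) (int b))"
    for f :: "int \<Rightarrow> int \<Rightarrow> int"
  define A where "A = solution_sum n (\<lambda>a b x y. b < a) (\<lambda>a b x y. (int a)\<^sup>2)"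
  define B where "B = solution_sum n (\<lambda>a b x y. x < y) (\<lambda>a b x y. (int a)\<^sup>2)"
  define T where "T = solution_sum n (\<lambda>a b x y. x < y) (\<lambda>a b x y. int a * int b)"
  have plus: "all (\<lambda>a b. (a + b)\<^sup>2) = 2 * A + parts_eq (\<lambda>a b. (a + b)\<^sup>2)"
    using solution_sum_symmetric(1)[of "\<lambda>a b. (int a + int b)\<^sup>2" n]
      solution_sum_shear[of n "\<lambda>a b. (int a)\<^sup>2"]
    by (simp add: all_def parts_eq_def A_def add.commute)
  have "solution_sum n (\<lambda>a b x y. a = b) (\<lambda>a b x y. (int a - int b)\<^sup>2) = 0"
    unfolding solution_sum_def by (intro sum.neutral) auto
  then have minus: "all (\<lambda>a b. (a - b)\<^sup>2) = 2 * B"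
    using solution_sum_symmetric(2)[of "\<lambda>a b. (int a - int b)\<^sup>2" n]
      solution_sum_shear[of n "\<lambda>a b. (int a - int b)\<^sup>2"]
    by (simp add: all_def B_def power2_commute)
  have times: "all (\<lambda>a b. a * b) = 2 * T + parts_eq (\<lambda>a b. a * b)"
    using solution_sum_symmetric(1)[of "\<lambda>a b. int a * int b" n]
    by (simp add: all_def parts_eq_def T_def mult.commute)
  have "4 * all (\<lambda>a b. a * b) = all (\<lambda>a b. (a + b)\<^sup>2 - (a - b)\<^sup>2)"
    unfolding all_def solution_sum_mult[symmetric]
    by (rule solution_sum_cong) (auto simp: power2_eq_square algebra_simps)
  also have "\<dots> = all (\<lambda>a b. (a + b)\<^sup>2) - all (\<lambda>a b. (a - b)\<^sup>2)"
    unfolding all_def by (rule solution_sum_diff)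
  finally have polarization: "4 * all (\<lambda>a b. a * b) = all (\<lambda>a b. (a + b)\<^sup>2) - all (\<lambda>a b. (a - b)\<^sup>2)" .
  \<comment> \<open>The step that eliminates \<open>A - B\<close>, leaving only divisor sums.\<close>
  have AB: "A = B + parts_eq (\<lambda>a b. a\<^sup>2) - (\<Sum>d | d dvd n. (int (n div d) - 1) * (int d)\<^sup>2)"
    unfolding A_def B_def parts_eq_def by (rule solution_sum_compare[OF assms])
  have "parts_eq (\<lambda>a b. (a + b)\<^sup>2) - 4 * parts_eq (\<lambda>a b. a * b) + 2 * parts_eq (\<lambda>a b. a\<^sup>2)
      = parts_eq (\<lambda>a b. (a + b)\<^sup>2 - 4 * (a * b) + 2 * a\<^sup>2)"
    unfolding parts_eq_def by (simp only: solution_sum_add solution_sum_diff solution_sum_mult)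
  also have "\<dots> = parts_eq (\<lambda>a b. 2 * a\<^sup>2 + (a - b)\<^sup>2)"
    unfolding parts_eq_def
    by (rule solution_sum_cong) (auto simp: power2_eq_square algebra_simps)
  also have "\<dots> = (\<Sum>d | d dvd n. int d ^ 3 - 2 * (int d)\<^sup>2 + int d)"
    unfolding parts_eq_def
    by (subst solution_sum_diagonal[OF assms]) (simp only: sum_below_quadratic)
  finally have "8 * T = (\<Sum>d | d dvd n. int d ^ 3 - 2 * (int d)\<^sup>2 + int d)
      - 2 * (\<Sum>d | d dvd n. (int (n div d) - 1) * (int d)\<^sup>2)"
    using plus minus times polarization AB by linarith
  also have "\<dots> = (\<Sum>d | d dvd n. int d ^ 3 - (2 * int n - 1) * int d)"
    unfolding sum_distrib_left sum_subtractf[symmetric]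
  proof (rule sum.cong)
    fix d assume "d \<in> {d. d dvd n}"
    then have "int n = int (n div d) * int d" by (metis dvd_div_mult_self mem_Collect_eq of_nat_mult)
    then show "int d ^ 3 - 2 * (int d)\<^sup>2 + int d - 2 * ((int (n div d) - 1) * (int d)\<^sup>2)
        = int d ^ 3 - (2 * int n - 1) * int d"
      by (simp add: power2_eq_square algebra_simps)
  qed simp
  finally show ?thesis
    by (simp add: T_def sum_subtractf sum_distrib_left)
qed

section \<open>The coefficients of U as a sum over solutions\<close>

text \<open>The expansion of \<open>q ^ k / (1 - q ^ k)\<^sup>2\<close>, which is \<open>\<Sum> m * q ^ (m * k)\<close>.\<close>

definition double_pole :: "nat \<Rightarrow> rat fps" where
  "double_pole k = Abs_fps (\<lambda>n. if k dvd n then of_nat (n div k) else 0)"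

lemma double_pole_mult:
  assumes "0 < k"
  shows "double_pole k * (1 - fps_X ^ k) ^ 2 = fps_X ^ k"
proof -
  \<comment> \<open>The simple pole \<open>1 / (1 - q ^ k)\<close>: one factor of the denominator is removed at a time.\<close>
  define h :: "rat fps" where "h = Abs_fps (\<lambda>n. if k dvd n then 1 else 0)"
  have h: "h * (1 - fps_X ^ k) = 1"
  proof (rule fps_ext)
    fix n
    show "fps_nth (h * (1 - fps_X ^ k)) n = fps_nth 1 n"
      using assms by (cases "n < k")
        (auto simp: h_def right_diff_distrib fps_X_power_mult_right_nth nat_dvd_not_less
          dvd_minus_self)
  qed
  have "double_pole k * (1 - fps_X ^ k) = h * fps_X ^ k"
  proof (rule fps_ext)
    fix n
    show "fps_nth (double_pole k * (1 - fps_X ^ k)) n = fps_nth (h * fps_X ^ k) n"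
    proof (cases "n < k")
      case True
      then show ?thesis
        by (auto simp: double_pole_def right_diff_distrib fps_X_power_mult_right_nth nat_dvd_not_less)
    next
      case False
      then have "n div k = Suc ((n - k) div k)" using assms by (simp add: le_div_geq)
      then show ?thesis
        using False by (auto simp: double_pole_def h_def right_diff_distrib
          fps_X_power_mult_right_nth dvd_minus_self)
    qed
  qed
  then have "double_pole k * (1 - fps_X ^ k) ^ 2 = h * fps_X ^ k * (1 - fps_X ^ k)"
    by (simp only: power2_eq_square mult.assoc[symmetric])
  also have "\<dots> = fps_X ^ k * (h * (1 - fps_X ^ k))"
    by (simp only: mult_ac)
  finally show ?thesis by (simp add: h)
qed

lemma U_term_pair:
  assumes "0 < x" "0 < y"
  shows "U_term [x, y] = double_pole x * double_pole y"
proof -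
  have nz: "(1 - fps_X ^ k :: rat fps) ^ 2 \<noteq> 0" if "0 < k" for k
    using double_pole_mult[OF that] by (metis mult_zero_right power_not_zero fps_X_neq_zero)
  have "fps_X ^ (x + y)
      = (double_pole x * (1 - fps_X ^ x) ^ 2) * (double_pole y * (1 - fps_X ^ y) ^ 2)"
    by (simp only: power_add double_pole_mult[OF assms(1)] double_pole_mult[OF assms(2)])
  also have "\<dots> = (double_pole x * double_pole y) * ((1 - fps_X ^ x) ^ 2 * (1 - fps_X ^ y) ^ 2)"
    by (simp only: mult_ac)
  finally show ?thesis
    using nz[OF assms(1)] nz[OF assms(2)] by (simp add: U_term_def)
qed

text \<open>
  In the Cauchy product of the two expansions, the exponent \<open>i\<close> of the first factor is the share
  \<open>a * x\<close> of the smaller part \<open>x\<close> in \<open>n\<close>.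
\<close>

lemma MO_2_eq_solution_sum:
  "MO 2 n = solution_sum n (\<lambda>a b x y. x < y) (\<lambda>a b x y. int a * int b)"
proof -
  let ?K = "{ks. ks \<in> strict_tuples 2 \<and> sum_list ks \<le> n}"
  let ?c = "\<lambda>ks i. fps_nth (double_pole (ks ! 0)) i * fps_nth (double_pole (ks ! 1)) (n - i)"
  have pair: "ks = [ks ! 0, ks ! 1] \<and> 0 < ks ! 0 \<and> ks ! 0 < ks ! 1" if "ks \<in> strict_tuples 2" for ks
    using that by (auto simp: strict_tuples_def numeral_2_eq_2 length_Suc_conv)
  have finK: "finite ?K" using finite_strict_tuples_le[of 2 n] by simp
  have "(of_int (MO 2 n) :: rat) = (\<Sum>ks\<in>?K. fps_nth (U_term ks) n)"
    unfolding of_int_MO U_nth ..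
  also have "\<dots> = (\<Sum>ks\<in>?K. \<Sum>i=0..n. ?c ks i)"
  proof (rule sum.cong)
    fix ks assume "ks \<in> ?K"
    then have "U_term ks = double_pole (ks ! 0) * double_pole (ks ! 1)"
      using pair[of ks] U_term_pair[of "ks ! 0" "ks ! 1"] by (metis (no_types, lifting) mem_Collect_eq order.strict_trans)
    then show "fps_nth (U_term ks) n = (\<Sum>i=0..n. ?c ks i)"
      by (simp add: fps_mult_nth)
  qed simp
  also have "\<dots> = (\<Sum>(ks, i)\<in>?K \<times> {0..n}. ?c ks i)"
    using finK by (simp add: sum.cartesian_product)
  also have "\<dots> = (\<Sum>(a, b, x, y) | (a, b, x, y) \<in> solutions n \<and> x < y. of_nat a * of_nat b)"
    \<comment> \<open>\<open>T'\<close> collects the index pairs with vanishing coefficient; they come from no solution.\<close>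
  proof (rule sym, rule sum.reindex_bij_witness_not_neutral[where S' = "{}" and
        T' = "{(ks, i) \<in> ?K \<times> {0..n}. \<not> (0 < i \<and> i < n \<and> ks ! 0 dvd i \<and> ks ! 1 dvd n - i)}"
        and j = "\<lambda>(a, b, x, y). ([x, y], a * x)"
        and i = "\<lambda>(ks, i). (i div ks ! 0, (n - i) div ks ! 1, ks ! 0, ks ! 1)"], goal_cases)
    case 2
    show ?case by (rule finite_subset[of _ "?K \<times> {0..n}"]) (use finK in auto)
  next
    case (3 s)
    then obtain a b x y where s: "s = (a, b, x, y)" "0 < a" "0 < b" "0 < x" "0 < y"
        "a * x + b * y = n" by (auto simp: solutions_def)
    have "n - a * x = b * y" using s(6) by simp
    then show ?case using s by simp
  next
    case (4 s)
    then obtain a b x y where s: "s = (a, b, x, y)" "0 < a" "0 < b" "0 < x" "x < y"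
        "a * x + b * y = n" by (auto simp: solutions_def)
    have diff: "n - a * x = b * y" using s(6) by simp
    have pos: "0 < a * x" "0 < b * y" using s by simp_all
    have "1 * x \<le> a * x" "1 * y \<le> b * y" using s by (intro mult_le_mono; simp)+
    then have "x + y \<le> n" "a * x < n" using s(6) pos by linarith+
    then show ?case using s diff pos by (auto simp: strict_tuples_def)
  next
    case (5 p)
    then obtain ks i where p: "p = (ks, i)" "ks \<in> strict_tuples 2" "ks ! 0 dvd i" by auto
    then show ?case using pair[of ks] by simp
  next
    case (6 p)
    then obtain ks i where p: "p = (ks, i)" "ks \<in> strict_tuples 2" "ks ! 0 dvd i" "ks ! 1 dvd n - i"
        "0 < i" "i < n" by auto
    then have "0 < i div ks ! 0" "0 < (n - i) div ks ! 1"
      using pair[of ks] by (simp_all add: div_greater_zero_iff dvd_imp_le)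
    then show ?case using p pair[of ks] by (auto simp: solutions_def)
  next
    case (8 p)
    then show ?case by (auto simp: double_pole_def)
  next
    case (9 s)
    then obtain a b x y where s: "s = (a, b, x, y)" "0 < x" "0 < y" "a * x + b * y = n"
      by (auto simp: solutions_def)
    have "n - a * x = b * y" using s(4) by simp
    then show ?case using s by (simp add: double_pole_def)
  qed simp_all
  also have "\<dots> = of_int (solution_sum n (\<lambda>a b x y. x < y) (\<lambda>a b x y. int a * int b))"
    by (simp add: solution_sum_def case_prod_unfold)
  finally show ?thesis by (simp only: of_int_eq_iff)
qed

lemma MO_2_divisor_sum:
  assumes "0 < n"
  shows "8 * MO 2 n = (\<Sum>d | d dvd n. int d ^ 3) - (2 * int n - 1) * (\<Sum>d | d dvd n. int d)"
  using solution_sum_product[OF assms] by (simp add: MO_2_eq_solution_sum)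

section \<open>The divisor sum modulo 5\<close>

lemma inverse_mod_5_cubes:
  fixes d e :: int
  assumes "d * e mod 5 = 1"
  shows "5 dvd (d ^ 3 - d) + (e ^ 3 - e)"
proof -
  have "(d mod 5) * (e mod 5) mod 5 = 1" using assms by (simp add: mod_simps)
  moreover have "r mod 5 = 0 \<or> r mod 5 = 1 \<or> r mod 5 = 2 \<or> r mod 5 = 3 \<or> r mod 5 = 4" for r :: int
    by presburger
  note this[of d] this[of e]
  ultimately have "(((d mod 5) ^ 3 - d mod 5) + ((e mod 5) ^ 3 - e mod 5)) mod 5 = 0"
    by (elim disjE) simp_all
  moreover have "((d ^ 3 - d) + (e ^ 3 - e)) mod 5
      = (((d mod 5) ^ 3 - d mod 5) + ((e mod 5) ^ 3 - e mod 5)) mod 5"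
    by (intro mod_add_cong mod_diff_cong) (simp_all add: power_mod)
  ultimately show ?thesis by (simp only: dvd_eq_mod_eq_0)
qed

lemma divisor_sum_cube_minus_mod_5:
  fixes n :: nat
  assumes "n mod 5 = 1"
  shows "5 dvd (\<Sum>d | d dvd n. int d ^ 3 - int d)"
proof -
  let ?f = "\<lambda>d. int d ^ 3 - int d"
  have n: "0 < n" using assms by (cases n) auto
  \<comment> \<open>Summing each pair of complementary divisors twice avoids choosing a representative of
    the pair; the factor 2 is invertible modulo 5.\<close>
  have "(\<Sum>d | d dvd n. ?f d) = (\<Sum>d | d dvd n. ?f (n div d))"
    by (rule sum.reindex_bij_witness[where i = "\<lambda>d. n div d" and j = "\<lambda>d. n div d"])
      (use n in \<open>auto elim!: dvdE\<close>)
  then have "2 * (\<Sum>d | d dvd n. ?f d) = (\<Sum>d | d dvd n. ?f d + ?f (n div d))"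
    by (simp add: sum.distrib)
  also have "5 dvd \<dots>"
  proof (rule dvd_sum)
    fix d assume "d \<in> {d. d dvd n}"
    then have "int d * int (n div d) = int n" by (metis dvd_mult_div_cancel mem_Collect_eq of_nat_mult)
    moreover have "int n mod 5 = 1" using assms by (metis of_nat_1 of_nat_numeral zmod_int)
    ultimately show "5 dvd ?f d + ?f (n div d)" by (intro inverse_mod_5_cubes) simp
  qed
  finally show ?thesis by (simp add: coprime_dvd_mult_right_iff)
qed

theorem theorem8p3:
  fixes n :: nat
  shows "5 dvd MO 2 (5 * n + 1)"
proof -
  let ?m = "5 * n + 1"
  have "8 * MO 2 ?m = (\<Sum>d | d dvd ?m. int d ^ 3 - int d) - 5 * (2 * int n * (\<Sum>d | d dvd ?m. int d))"
    by (subst MO_2_divisor_sum) (simp_all add: sum_subtractf algebra_simps)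
  moreover have "5 dvd (\<Sum>d | d dvd ?m. int d ^ 3 - int d)"
    by (rule divisor_sum_cube_minus_mod_5) simp
  ultimately have "5 dvd 8 * MO 2 ?m" by (simp only: dvd_diff dvd_triv_left)
  then show ?thesis by presburger
qed

end
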